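(* Let $\mathbb{S}$ be any set of 2-systems and $\mathbb{H}$ any set of hypersequent rules such that for every $\textit{Sys}\in\mathbb{S}$ the hypersequent rule $\textit{Hr}_{\textit{Sys}}$ belongs to $\mathbb{H}$. If the sequent $\Gamma\Rightarrow\Pi$ is derivable in $\mathrm{LJ}+\mathbb{S}$, then $\Gamma\Rightarrow\Pi$ (viewed as a one-component hypersequent) is derivable in $\mathrm{HLJ}+\mathbb{H}$.
   Context: Sequents have the form $\Gamma\Rightarrow\Pi$ with $\Gamma$ a finite multiset of propositional intuitionistic formulae and $\Pi$ containing at most one formula. $\mathrm{LJ}$ is the standard propositional sequent calculus for intuitionistic logic with axioms $\varphi\Rightarrow\varphi$, $\bot\Rightarrow\Pi$, the left/right rules for $\wedge,\vee,\to$, internal weakening, internal contraction and cut. A hypersequent is a finite multiset of sequents (components) written $\Gamma_1\Rightarrow\Pi_1\mid\dots\mid\Gamma_k\Rightarrow\Pi_k$. $\mathrm{HLJ}$ has the same axioms and the rules of $\mathrm{LJ}$ with an arbitrary hypersequent context $G$ added to the conclusion and to every premiss (shared by all premisses), plus external weakening (from $G$ infer $G\mid\Gamma\Rightarrow\Pi$) and external contraction (from $G\mid\Gamma\Rightarrow\Pi\mid\Gamma\Rightarrow\Pi$ infer $G\mid\Gamma\Rightarrow\Pi$). For a calculus $\mathcal C$ and set of rules $\mathbb R$, $\mathcal C+\mathbb R$ is $\mathcal C$ extended by $\mathbb R$. A 2-system is a set of sequent rules $\{(r_1),\dots,(r_k),(r_B)\}$ (top rules $(r_i)$, bottom rule $(r_B)$)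 that may only be used as follows: $(r_B)$ infers $\Gamma\Rightarrow\Pi$ from $k$ premisses all equal to $\Gamma\Rightarrow\Pi$, where the derivation $\mathcal D_i$ of the $i$-th premiss may contain (possibly several) applications of the top rule $(r_i)$, which has the form: from $\Sigma_1,\Gamma'\Rightarrow\Pi'\ \dots\ \Sigma_n,\Gamma'\Rightarrow\Pi'$ infer $\Sigma_0,\Gamma'\Rightarrow\Pi'$, all applications of the top rules of the same instance acting on the same multisets $\Sigma_0,\dots,\Sigma_n$ (top rules are only applicable in this way, above the premisses of their bottom rule, which discharges them). Given a 2-system $\textit{Sys}$ whose top rule $(r_i)$ ($1\le i\le k$) infers $\theta_i^1,\dots,\theta_i^{n_i},\Gamma_i\Rightarrow\Pi_i$ from premisses $S_i^1,\dots,S_i^{p_i}$ (each of the form (list of formulae), $\Gamma_i\Rightarrow\Pi_i$), the hypersequent rule $\textit{Hr}_{\textit{Sys}}$ infers $G\mid\theta_1^1,\dots,\theta_1^{n_1},\Gamma_1\Rightarrow\Pi_1\mid\dots\mid\theta_k^1,\dots,\theta_k^{n_k},\Gamma_k\Rightarrow\Pi_k$ from the premisses $G\mid S_i^j$ for all $1\le i\le k$, $1\le j\le p_i$. *)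

theory Defs
  imports Main "HOL-Library.Multiset"
begin

datatype 'a form =
    Atom 'a
  | Bot
  | And "'a form" "'a form"
  | Or "'a form" "'a form"
  | Imp "'a form" "'a form"

(* The succedent is an option because it holds at most one formula. *)
datatype 'a sequent =
  Sequent "'a form multiset" "'a form option"  (infix "\<Rrightarrow>" 55)

type_synonym 'a hypersequent = "'a sequent multiset"

inductive lj_axiom :: "'a sequent \<Rightarrow> bool" where
  identity: "lj_axiom ({#A#} \<Rrightarrow> Some A)"
| botL: "lj_axiom ({#Bot#} \<Rrightarrow> \<Pi>)"

(* lj_rule premisses conclusion *)
inductive lj_rule :: "'a sequent list \<Rightarrow> 'a sequent \<Rightarrow> bool" where
  andL: "lj_rule [add_mset A (add_mset B \<Gamma>) \<Rrightarrow> \<Pi>] (add_mset (And A B) \<Gamma> \<Rrightarrow> \<Pi>)"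
| andR: "lj_rule [\<Gamma> \<Rrightarrow> Some A, \<Gamma> \<Rrightarrow> Some B] (\<Gamma> \<Rrightarrow> Some (And A B))"
| orL: "lj_rule [add_mset A \<Gamma> \<Rrightarrow> \<Pi>, add_mset B \<Gamma> \<Rrightarrow> \<Pi>] (add_mset (Or A B) \<Gamma> \<Rrightarrow> \<Pi>)"
| orR1: "lj_rule [\<Gamma> \<Rrightarrow> Some A] (\<Gamma> \<Rrightarrow> Some (Or A B))"
| orR2: "lj_rule [\<Gamma> \<Rrightarrow> Some B] (\<Gamma> \<Rrightarrow> Some (Or A B))"
| impL: "lj_rule [\<Gamma> \<Rrightarrow> Some A, add_mset B \<Gamma> \<Rrightarrow> \<Pi>] (add_mset (Imp A B) \<Gamma> \<Rrightarrow> \<Pi>)"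
| impR: "lj_rule [add_mset A \<Gamma> \<Rrightarrow> Some B] (\<Gamma> \<Rrightarrow> Some (Imp A B))"
| weakL: "lj_rule [\<Gamma> \<Rrightarrow> \<Pi>] (add_mset A \<Gamma> \<Rrightarrow> \<Pi>)"
| weakR: "lj_rule [\<Gamma> \<Rrightarrow> None] (\<Gamma> \<Rrightarrow> Some A)"
| contrL: "lj_rule [add_mset A (add_mset A \<Gamma>) \<Rrightarrow> \<Pi>] (add_mset A \<Gamma> \<Rrightarrow> \<Pi>)"
| cut: "lj_rule [\<Gamma> \<Rrightarrow> Some A, add_mset A \<Delta> \<Rrightarrow> \<Pi>] (\<Gamma> + \<Delta> \<Rrightarrow> \<Pi>)"

(* A top rule whose active multisets have been fixed: (S0, [S1, ..., Sn]) is the rule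
   inferring S0, \<Gamma>' \<Rrightarrow> \<Pi>' from the premisses Sj, \<Gamma>' \<Rrightarrow> \<Pi>' (j = 1, ..., n), for all \<Gamma>', \<Pi>'. *)
type_synonym 'a top_rule = "'a form multiset \<times> 'a form multiset list"

(* Rules are represented by the sets of their instances.  The top rules r_1, ..., r_k of a
   2-system share their metavariables, so they are instantiated simultaneously: an element
   [t_1, ..., t_k] of a 2-system gives the active multisets of all k top rules under one
   instantiation.  The bottom rule is determined by k. *)
type_synonym 'a two_system = "'a top_rule list set"

(* Every instance has the same number k of top rules, and the i-th top rule has the same
   number of premisses in every instance. *)
definition two_system :: "'a two_system \<Rightarrow> bool" where
  "two_system Sys \<longleftrightarrow> (\<exists>ps :: nat list. \<forall>ts\<in>Sys. map (length \<circ> snd) ts = ps)"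

(* lj_sys SS T S: there is an LJ + SS derivation of S in which every application of a top
   rule belongs to a bottom rule inside the derivation, or else is an application of an
   undischarged top rule from T.  The i-th premiss of a bottom rule is derived with the
   i-th top rule of the chosen instance additionally available; the bottom rule
   discharges it. *)
inductive lj_sys :: "'a two_system set \<Rightarrow> 'a top_rule set \<Rightarrow> 'a sequent \<Rightarrow> bool"
  for SS :: "'a two_system set" where
  ax: "lj_axiom S \<Longrightarrow> lj_sys SS T S"
| lj: "lj_rule Ps S \<Longrightarrow> (\<And>P. P \<in> set Ps \<Longrightarrow> lj_sys SS T P) \<Longrightarrow> lj_sys SS T S"
| top: "(\<Sigma>0, \<Sigma>s) \<in> T \<Longrightarrow> (\<And>\<Sigma>. \<Sigma> \<in> set \<Sigma>s \<Longrightarrow> lj_sys SS T (\<Sigma> + \<Gamma>' \<Rrightarrow> \<Pi>'))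
    \<Longrightarrow> lj_sys SS T (\<Sigma>0 + \<Gamma>' \<Rrightarrow> \<Pi>')"
| bottom: "Sys \<in> SS \<Longrightarrow> ts \<in> Sys
    \<Longrightarrow> (\<And>i. i < length ts \<Longrightarrow> lj_sys SS (insert (ts ! i) T) (\<Gamma> \<Rrightarrow> \<Pi>))
    \<Longrightarrow> lj_sys SS T (\<Gamma> \<Rrightarrow> \<Pi>)"

definition LJ_derivable :: "'a two_system set \<Rightarrow> 'a sequent \<Rightarrow> bool" where
  "LJ_derivable SS S \<longleftrightarrow> lj_sys SS {} S"

(* A hypersequent rule is the set of its instances (premisses, conclusion). *)
type_synonym 'a hyper_rule = "('a hypersequent list \<times> 'a hypersequent) set"

inductive HLJ_derivable :: "'a hyper_rule set \<Rightarrow> 'a hypersequent \<Rightarrow> bool"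
  for HH :: "'a hyper_rule set" where
  ax: "lj_axiom S \<Longrightarrow> HLJ_derivable HH {#S#}"
| lj: "lj_rule Ps S \<Longrightarrow> (\<And>P. P \<in> set Ps \<Longrightarrow> HLJ_derivable HH (add_mset P G))
    \<Longrightarrow> HLJ_derivable HH (add_mset S G)"
| ew: "HLJ_derivable HH G \<Longrightarrow> HLJ_derivable HH (add_mset S G)"
| ec: "HLJ_derivable HH (add_mset S (add_mset S G)) \<Longrightarrow> HLJ_derivable HH (add_mset S G)"
| ext: "R \<in> HH \<Longrightarrow> (Hs, H) \<in> R \<Longrightarrow> (\<And>H'. H' \<in> set Hs \<Longrightarrow> HLJ_derivable HH H')
    \<Longrightarrow> HLJ_derivable HH H"

(* Each of the k components of the conclusion has its own context \<Gamma> i \<Rrightarrow> \<Pi> i. *)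
definition Hr :: "'a two_system \<Rightarrow> 'a hyper_rule" where
  "Hr Sys = {([add_mset (\<Sigma> + \<Gamma> i \<Rrightarrow> \<Pi> i) G. i \<leftarrow> [0..<length ts], \<Sigma> \<leftarrow> snd (ts ! i)],
              G + mset [fst (ts ! i) + \<Gamma> i \<Rrightarrow> \<Pi> i. i \<leftarrow> [0..<length ts]])
             | ts G (\<Gamma> :: nat \<Rightarrow> 'a form multiset) (\<Pi> :: nat \<Rightarrow> 'a form option). ts \<in> Sys}"

end

(* Call a set M of sequents refuted if no hypersequent over M is derivable, and extend
   \<Gamma> \<Rrightarrow> \<Pi>, if it is underivable, to a maximal refuted set M by Zorn's lemma.  The sequents
   outside M, regarded as true, are closed under the rules of LJ.  If each top rule of an
   instance of a 2-system had a counterexample, that is, true premisses and a conclusion in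
   M, then the hypersequent rule would derive the hypersequent of these conclusions.  Hence
   one of the top rules preserves truth, and truth passes through the corresponding
   premiss of the bottom rule.  So every LJ + SS derivable sequent is true, contradicting
   \<Gamma> \<Rrightarrow> \<Pi> being in M. *)
theory Submission
  imports Defs
begin

lemma HLJ_weaken: "HLJ_derivable HH G \<Longrightarrow> HLJ_derivable HH (G + H)"
  by (induction H) (auto intro: HLJ_derivable.ew)

text \<open>Repeated external contraction merges the copies of \<open>S\<close>; for
  \<open>n = 0\<close> the single copy comes from external weakening instead.\<close>

lemma HLJ_contract:
  "HLJ_derivable HH (replicate_mset n S + G) \<Longrightarrow> HLJ_derivable HH (add_mset S G)"
proof (induction n)
  case 0
  then show ?case by (simp add: HLJ_derivable.ew)
next
  case (Suc n)
  show ?case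
  proof (cases n)
    case 0
    with Suc.prems show ?thesis by simp
  next
    case (Suc m)
    with Suc.prems have "HLJ_derivable HH (replicate_mset n S + G)"
      using HLJ_derivable.ec[of HH S "replicate_mset m S + G"] by simp
    then show ?thesis by (rule Suc.IH)
  qed
qed

definition refuted :: "'a hyper_rule set \<Rightarrow> 'a sequent set \<Rightarrow> bool" where
  "refuted HH M \<longleftrightarrow> (\<forall>G. set_mset G \<subseteq> M \<longrightarrow> \<not> HLJ_derivable HH G)"

text \<open>The second conjunct expresses maximality among refuted sets. One copy of
  \<open>S\<close> suffices because further copies can be contracted externally.\<close>

definition saturated :: "'a hyper_rule set \<Rightarrow> 'a sequent set \<Rightarrow> bool" where
  "saturated HH M \<longleftrightarrow> refuted HH M \<and>
     (\<forall>S. S \<notin> M \<longrightarrow> (\<exists>G. set_mset G \<subseteq> M \<and> HLJ_derivable HH (add_mset S G)))"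

lemma refuted_singleton:
  assumes "\<not> HLJ_derivable HH {#S#}"
  shows "refuted HH {S}"
  unfolding refuted_def
proof (intro allI impI notI)
  fix G assume "set_mset G \<subseteq> {S}" "HLJ_derivable HH G"
  then have "HLJ_derivable HH (replicate_mset (size G) S + {#})"
    using set_mset_subset_singletonD by fastforce
  from HLJ_contract[OF this] assms show False by simp
qed

text \<open>A hypersequent has only finitely many components, so one over the union of a chain
  already lies over a single member.\<close>

lemma refuted_Union_chain:
  assumes "C \<noteq> {}" "subset.chain {M. refuted HH M} C"
  shows "refuted HH (\<Union>C)"
  unfolding refuted_def
proof (intro allI impI)
  fix G assume "set_mset G \<subseteq> \<Union>C"
  then obtain M where "M \<in> C" "set_mset G \<subseteq> M"
    by (rule finite_subset_Union_chain[OF finite_set_mset _ assms])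
  with assms(2) show "\<not> HLJ_derivable HH G"
    by (auto simp: subset.chain_def refuted_def)
qed

lemma derivable_over_insert:
  assumes "set_mset G \<subseteq> insert S M" "HLJ_derivable HH G"
  obtains G' where "set_mset G' \<subseteq> M" "HLJ_derivable HH (add_mset S G')"
proof
  show "set_mset (filter_mset (\<lambda>x. x \<noteq> S) G) \<subseteq> M"
    using assms(1) by auto
  have "G = replicate_mset (count G S) S + filter_mset (\<lambda>x. x \<noteq> S) G"
    by (rule multiset_eqI) simp
  with assms(2) have "HLJ_derivable HH (replicate_mset (count G S) S + filter_mset (\<lambda>x. x \<noteq> S) G)"
    by argo
  then show "HLJ_derivable HH (add_mset S (filter_mset (\<lambda>x. x \<noteq> S) G))"
    by (rule HLJ_contract)
qed

lemma saturated_extension: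
  assumes "\<not> HLJ_derivable HH {#S#}"
  obtains M where "saturated HH M" "S \<in> M"
proof -
  let ?A = "{M. refuted HH M \<and> S \<in> M}"
  have "\<exists>M\<in>?A. \<forall>X\<in>?A. M \<subseteq> X \<longrightarrow> X = M"
  proof (rule subset_Zorn_nonempty)
    show "?A \<noteq> {}" using refuted_singleton[OF assms] by blast
  next
    fix C assume C: "C \<noteq> {}" "subset.chain ?A C"
    then have "refuted HH (\<Union>C)"
      by (intro refuted_Union_chain) (auto simp: subset.chain_def)
    moreover have "S \<in> \<Union>C"
      using C unfolding subset.chain_def by blast
    ultimately show "\<Union>C \<in> ?A" by simp
  qed
  then obtain M where "M \<in> ?A" and maximal: "\<forall>X\<in>?A. M \<subseteq> X \<longrightarrow> X = M" ..
  then have M: "refuted HH M" "S \<in> M" by simp_all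
  have max: "X = M" if "refuted HH X" "M \<subseteq> X" for X
    using maximal that M(2) by (simp add: subset_iff)
  have "\<exists>G. set_mset G \<subseteq> M \<and> HLJ_derivable HH (add_mset U G)" if "U \<notin> M" for U
  proof -
    \<comment> \<open>Maximality applies to \<open>insert U M\<close>, which still contains
      \<open>S\<close>.\<close>
    have "\<not> refuted HH (insert U M)"
      using max[of "insert U M"] that by auto
    then obtain G where "set_mset G \<subseteq> insert U M" "HLJ_derivable HH G"
      unfolding refuted_def by blast
    then show ?thesis
      by (rule derivable_over_insert) blast
  qed
  with M(1) have "saturated HH M" by (simp add: saturated_def)
  then show ?thesis using M(2) by (rule that)
qed

text \<open>Rules of HLJ share one context among all premisses. The contexts witnessing that the
  single sequents lie outside \<open>M\<close> are added up, and external weakening adapts each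
  derivation to the sum.\<close>

lemma saturated_common_context:
  assumes "saturated HH M" "finite A" "A \<inter> M = {}"
  shows "\<exists>G. set_mset G \<subseteq> M \<and> (\<forall>S\<in>A. HLJ_derivable HH (add_mset S G))"
  using assms(2,3)
proof (induction A)
  case empty
  then show ?case by (intro exI[of _ "{#}"]) simp
next
  case (insert S A)
  then obtain G where G: "set_mset G \<subseteq> M" "\<forall>U\<in>A. HLJ_derivable HH (add_mset U G)"
    by auto
  from insert.prems assms(1) obtain H where H: "set_mset H \<subseteq> M" "HLJ_derivable HH (add_mset S H)"
    by (auto simp: saturated_def)
  have "HLJ_derivable HH (add_mset U (G + H))" if "U \<in> insert S A" for U
    using that G(2) H(2) HLJ_weaken[of HH "add_mset U G" H] HLJ_weaken[of HH "add_mset U H" G]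
    by (auto simp: add.commute)
  with G(1) H(1) show ?case by (intro exI[of _ "G + H"]) auto
qed

text \<open>True means outside \<open>M\<close>. All contexts are quantified over because a top rule
  may be applied repeatedly, with different contexts, above its bottom rule.\<close>

definition preserves_truth :: "'a sequent set \<Rightarrow> 'a top_rule \<Rightarrow> bool" where
  "preserves_truth M t \<longleftrightarrow> (\<forall>\<Gamma> \<Pi>. (\<forall>\<Sigma>\<in>set (snd t). (\<Sigma> + \<Gamma> \<Rrightarrow> \<Pi>) \<notin> M) \<longrightarrow> (fst t + \<Gamma> \<Rrightarrow> \<Pi>) \<notin> M)"

lemma saturated_top_rule:
  assumes M: "saturated HH M" and "Hr Sys \<in> HH" "ts \<in> Sys"
  shows "\<exists>i<length ts. preserves_truth M (ts ! i)"
proof (rule ccontr)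
  assume "\<not> ?thesis"
  then have "\<forall>i\<in>{..<length ts}. \<exists>c. (\<forall>\<Sigma>\<in>set (snd (ts ! i)). (\<Sigma> + fst c \<Rrightarrow> snd c) \<notin> M) \<and>
      (fst (ts ! i) + fst c \<Rrightarrow> snd c) \<in> M"
    by (simp add: preserves_truth_def)
  \<comment> \<open>One counterexample context is chosen per top rule. These may differ, just as the
    components of an \<open>Hr\<close> instance have independent contexts.\<close>
  from bchoice[OF this] obtain c where c: "\<forall>i\<in>{..<length ts}.
      (\<forall>\<Sigma>\<in>set (snd (ts ! i)). (\<Sigma> + fst (c i) \<Rrightarrow> snd (c i)) \<notin> M) \<and>
      (fst (ts ! i) + fst (c i) \<Rrightarrow> snd (c i)) \<in> M" ..
  define \<Gamma> \<Pi> where "\<Gamma> i = fst (c i)" and "\<Pi> i = snd (c i)" for i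
  have prem: "(\<Sigma> + \<Gamma> i \<Rrightarrow> \<Pi> i) \<notin> M" if "i < length ts" "\<Sigma> \<in> set (snd (ts ! i))" for i \<Sigma>
    using c that by (simp add: \<Gamma>_def \<Pi>_def)
  have concl: "(fst (ts ! i) + \<Gamma> i \<Rrightarrow> \<Pi> i) \<in> M" if "i < length ts" for i
    using c that by (simp add: \<Gamma>_def \<Pi>_def)
  \<comment> \<open>The premisses of all \<open>k\<close> top rules are collected at once, since the
    hypersequent rule needs the same \<open>G\<close> in each of them.\<close>
  let ?A = "\<Union>i\<in>{..<length ts}. (\<lambda>\<Sigma>. \<Sigma> + \<Gamma> i \<Rrightarrow> \<Pi> i) ` set (snd (ts ! i))"
  have "finite ?A" "?A \<inter> M = {}" using prem by auto
  from saturated_common_context[OF M this] obtain G where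
    G: "set_mset G \<subseteq> M" "\<forall>S\<in>?A. HLJ_derivable HH (add_mset S G)"
    by (elim exE conjE)
  let ?Hs = "[add_mset (\<Sigma> + \<Gamma> i \<Rrightarrow> \<Pi> i) G. i \<leftarrow> [0..<length ts], \<Sigma> \<leftarrow> snd (ts ! i)]"
  let ?H = "G + mset [fst (ts ! i) + \<Gamma> i \<Rrightarrow> \<Pi> i. i \<leftarrow> [0..<length ts]]"
  have "(?Hs, ?H) \<in> Hr Sys"
    unfolding Hr_def mem_Collect_eq
    by (intro exI[of _ ts] exI[of _ G] exI[of _ \<Gamma>] exI[of _ \<Pi>] conjI refl assms(3))
  moreover have "HLJ_derivable HH H'" if "H' \<in> set ?Hs" for H'
  proof -
    from that obtain i \<Sigma> where "i < length ts" "\<Sigma> \<in> set (snd (ts ! i))"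
      and H': "H' = add_mset (\<Sigma> + \<Gamma> i \<Rrightarrow> \<Pi> i) G"
      by auto
    then have "(\<Sigma> + \<Gamma> i \<Rrightarrow> \<Pi> i) \<in> ?A" by blast
    then show ?thesis unfolding H' by (rule bspec[OF G(2)])
  qed
  ultimately have "HLJ_derivable HH ?H"
    by (rule HLJ_derivable.ext[OF assms(2)])
  moreover have "set_mset ?H \<subseteq> M"
    using G(1) concl by auto
  ultimately show False
    using M by (auto simp: saturated_def refuted_def)
qed

lemma lj_sys_true:
  assumes "lj_sys SS T S" "saturated HH M" "\<And>Sys. Sys \<in> SS \<Longrightarrow> Hr Sys \<in> HH"
    and "\<And>t. t \<in> T \<Longrightarrow> preserves_truth M t"
  shows "S \<notin> M"
  \<comment> \<open>The assumption on \<open>T\<close> goes through the induction because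
    \<open>bottom\<close> enlarges \<open>T\<close>.\<close>
  using assms(1,4)
proof (induction rule: lj_sys.induct)
  case (ax S T)
  show ?case
  proof
    assume "S \<in> M"
    then have "set_mset {#S#} \<subseteq> M" by simp
    with assms(2) HLJ_derivable.ax[OF ax(1)] show False
      unfolding saturated_def refuted_def by blast
  qed
next
  case (lj Ps S T)
  then have "set Ps \<inter> M = {}" by blast
  from saturated_common_context[OF assms(2) finite_set this] obtain G where
    G: "set_mset G \<subseteq> M" "\<forall>P\<in>set Ps. HLJ_derivable HH (add_mset P G)"
    by (elim exE conjE)
  then have "HLJ_derivable HH (add_mset S G)"
    using HLJ_derivable.lj[OF lj(1)] by blast
  show ?case
  proof
    assume "S \<in> M"
    with G(1) have "set_mset (add_mset S G) \<subseteq> M" by simp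
    with assms(2) \<open>HLJ_derivable HH (add_mset S G)\<close> show False
      unfolding saturated_def refuted_def by blast
  qed
next
  case (top \<Sigma>0 \<Sigma>s T \<Gamma>' \<Pi>')
  then have "preserves_truth M (\<Sigma>0, \<Sigma>s)" by blast
  with top show ?case by (simp add: preserves_truth_def)
next
  case (bottom Sys ts T \<Gamma> \<Pi>)
  \<comment> \<open>Only the \<open>i\<close>-th premiss is needed: its induction hypothesis
    applies, as every rule in \<open>insert (ts ! i) T\<close> preserves truth.\<close>
  then obtain i where "i < length ts" "preserves_truth M (ts ! i)"
    using saturated_top_rule[OF assms(2) assms(3)] by blast
  with bottom show ?case by blast
qed

theorem theorem1:
  fixes SS :: "'a two_system set" and HH :: "'a hyper_rule set"
    and \<Gamma> :: "'a form multiset" and \<Pi> :: "'a form option"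
  assumes "\<And>Sys. Sys \<in> SS \<Longrightarrow> two_system Sys"
    and "\<And>Sys. Sys \<in> SS \<Longrightarrow> Hr Sys \<in> HH"
    and "LJ_derivable SS (\<Gamma> \<Rrightarrow> \<Pi>)"
  shows "HLJ_derivable HH {#\<Gamma> \<Rrightarrow> \<Pi>#}"
proof (rule ccontr)
  assume "\<not> ?thesis"
  then obtain M where M: "saturated HH M" "(\<Gamma> \<Rrightarrow> \<Pi>) \<in> M"
    by (rule saturated_extension)
  from assms(3) have "lj_sys SS {} (\<Gamma> \<Rrightarrow> \<Pi>)"
    by (simp add: LJ_derivable_def)
  \<comment> \<open>For \<open>T = {}\<close> the condition on undischarged top rules is
    vacuous.\<close>
  from lj_sys_true[OF this M(1) assms(2)] M(2) show False by simp
qed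

end
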